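(* Let $\ell\in\mathbb{N}$ and $\mathbf{s}=(\{2\}^{a_1},c_1,\dots,\{2\}^{a_\ell},c_\ell,\{2\}^{a_{\ell+1}})$ with $a_j,c_j\in\mathbb{N}_0$ and $c_j\ge3$ for all $j$. Then for every positive integer $n$, $$H_n^\star[\mathbf{s}]=-\sum_{(\mathbf{p};\tilde{\mathbf{p}};\tilde{\tilde{\mathbf{p}}})\in\Pi(\mathbf{s})}\mathcal{H}_n[\mathbf{p};\tilde{\mathbf{p}};\tilde{\tilde{\mathbf{p}}}],$$ where $\Pi(\mathbf{s})$ is the set $$\{\overline{2a_1+2}\circ1^{\circ(c_1-3)}\circ(2a_2+3)\circ1^{\circ(c_2-3)}\circ\cdots\circ(2a_\ell+3)\circ1^{\circ(c_\ell-3)}\circ(2a_{\ell+1}+1);$$ $$(a_1+1)\circ0^{\circ(c_1-3)}\circ\cdots\circ(a_\ell+1)\circ0^{\circ(c_\ell-3)}\circ a_{\ell+1};\ 1\circ\theta^{\circ(c_1-2)}\circ\cdots\circ\theta^{\circ(c_\ell-2)}\}.$$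
   Context: Fix $0<q<1$. $[k]=(1-q^k)/(1-q)$; $(x;q)_n=\prod_{i=0}^{n-1}(1-xq^i)$; $\binom{n}{k}_q=(q;q)_n/((q;q)_k(q;q)_{n-k})$ for $0\le k\le n$, else $0$. $\{x\}^a$ denotes $a$ copies of $x$. Signed numbers: $\mathbb{D}_0=\mathbb{N}_0\cup\{\bar k:k\in\mathbb{N}_0\}$ ($\bar k$ a formal symbol), $|k|=|\bar k|=k$, $\operatorname{sgn}(k)=1$, $\operatorname{sgn}(\bar k)=-1$; $a\oplus b=\overline{|a|+|b|}$ if exactly one of $a,b$ is unbarred, $a+b$ if both unbarred, $|a|+|b|$ if both barred. For $\mathbf{s}\in\mathbb{D}_0^m$: $H_n^\star[\mathbf{s}]=\sum_{n\ge k_1\ge\cdots\ge k_m\ge1}\prod_{j}\operatorname{sgn}(s_j)^{k_j}q^{k_j}/[k_j]^{|s_j|}$. $\theta$ is a formal symbol; $Q(r,k)=rk(k-1)/2$ if $r\in\mathbb{Z},r>0$; $Q(r,k)=rk(k-1)/2-k$ if $r\in\mathbb{Z},r\le0$; $Q(\theta,k)=0$. On $\mathbb{Z}\cup\{\theta\}$: $\theta\boxplus a=a\boxplus\theta=a$; $a\boxplus b=a+b$ for integers with $(a,b)\neq(1,-1),(-1,1)$; $1\boxplus(-1)=\theta$, $(-1)\boxplus1=0$; iterated $\boxplus$ evaluated left to right. For $\mathbf{s}\in\mathbb{D}_0^m$, $\mathbf{t}\in\mathbb{N}_0^m$, $\mathbf{r}\in(\mathbb{Z}\cup\{\theta\})^m$,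 $m\ge1$: $$\mathcal{H}_n[\mathbf{s};\mathbf{t};\mathbf{r}]=\sum_{n\ge k_1>\cdots>k_m\ge1}\frac{\binom{n}{k_1}_q}{\binom{n+k_1}{k_1}_q}\prod_{j=1}^m\frac{\operatorname{sgn}(s_j)^{k_j}q^{t_jk_j+Q(r_j,k_j)}(1+q^{k_j})}{[k_j]^{|s_j|}}.$$ Merging notation: the set $\{x_1\circ\cdots\circ x_N;y_1\circ\cdots\circ y_N;z_1\circ\cdots\circ z_N\}$ consists of the triples obtained from all $2^{N-1}$ choices, for each of the $N-1$ gaps, of a comma or a merge (same choice in all three strings); each maximal run of merged entries becomes one entry: its $\oplus$-sum in the first string, ordinary sum in the second, $\boxplus$-combination in the third; sums over such a set run over all $2^{N-1}$ choices. $x^{\circ k}$ means $k$ copies of $x$ separated by $\circ$ (empty if $k=0$, with the adjoining $\circ$ dropped). *)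

theory Defs
  imports Complex_Main "HOL-Library.Multiset"
begin

definition q_number :: "real \<Rightarrow> nat \<Rightarrow> real" where
  "q_number q k = (1 - q ^ k) / (1 - q)"

definition q_pochhammer :: "real \<Rightarrow> real \<Rightarrow> nat \<Rightarrow> real" where
  "q_pochhammer x q n = (\<Prod>i<n. 1 - x * q ^ i)"

definition q_binomial :: "real \<Rightarrow> nat \<Rightarrow> nat \<Rightarrow> real" where
  "q_binomial q n k =
     (if k \<le> n then q_pochhammer q q n / (q_pochhammer q q k * q_pochhammer q q (n - k)) else 0)"

datatype signed_nat = Unbarred nat | Barred nat

fun signed_abs :: "signed_nat \<Rightarrow> nat" where
  "signed_abs (Unbarred k) = k"
| "signed_abs (Barred k) = k"

fun signed_sgn :: "signed_nat \<Rightarrow> real" where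
  "signed_sgn (Unbarred k) = 1"
| "signed_sgn (Barred k) = -1"

fun signed_plus :: "signed_nat \<Rightarrow> signed_nat \<Rightarrow> signed_nat" where
  "signed_plus (Unbarred a) (Unbarred b) = Unbarred (a + b)"
| "signed_plus (Unbarred a) (Barred b) = Barred (a + b)"
| "signed_plus (Barred a) (Unbarred b) = Barred (a + b)"
| "signed_plus (Barred a) (Barred b) = Unbarred (a + b)"

datatype int_theta = Integer int | Theta

text \<open>In the integer cases \<open>k * (k - 1)\<close> is even, so the integer division is exact.\<close>

fun Q_exponent :: "int_theta \<Rightarrow> nat \<Rightarrow> int" where
  "Q_exponent (Integer r) k =
     (if r > 0 then (r * int k * (int k - 1)) div 2 else (r * int k * (int k - 1)) div 2 - int k)"
| "Q_exponent Theta k = 0"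

text \<open>The last equation also covers \<open>(-1) \<boxplus> 1 = 0\<close>; the operation is not commutative.\<close>

fun theta_plus :: "int_theta \<Rightarrow> int_theta \<Rightarrow> int_theta" where
  "theta_plus Theta b = b"
| "theta_plus (Integer a) Theta = Integer a"
| "theta_plus (Integer a) (Integer b) = (if a = 1 \<and> b = -1 then Theta else Integer (a + b))"

text \<open>Index tuples \<open>(k\<^sub>1, \<dots>, k\<^sub>m)\<close> are lists, so \<open>k\<^sub>j\<close> is \<open>ks ! (j - 1)\<close>.\<close>

definition H_star :: "real \<Rightarrow> nat \<Rightarrow> signed_nat list \<Rightarrow> real" where
  "H_star q n s =
     (\<Sum>ks | length ks = length s \<and> set ks \<subseteq> {1..n} \<and> sorted_wrt (\<ge>) ks.
        \<Prod>j<length s. signed_sgn (s ! j) ^ (ks ! j) * q ^ (ks ! j)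
          / q_number q (ks ! j) ^ signed_abs (s ! j))"

text \<open>The three lists are meant to have the same positive length.\<close>

definition H_cal ::
  "real \<Rightarrow> nat \<Rightarrow> signed_nat list \<Rightarrow> nat list \<Rightarrow> int_theta list \<Rightarrow> real" where
  "H_cal q n s t r =
     (\<Sum>ks | length ks = length s \<and> set ks \<subseteq> {1..n} \<and> sorted_wrt (>) ks.
        q_binomial q n (ks ! 0) / q_binomial q (n + ks ! 0) (ks ! 0)
        * (\<Prod>j<length s. signed_sgn (s ! j) ^ (ks ! j)
             * q powi (int (t ! j * ks ! j) + Q_exponent (r ! j) (ks ! j))
             * (1 + q ^ (ks ! j))
             / q_number q (ks ! j) ^ signed_abs (s ! j)))"

text \<open>
  Entry \<open>i\<close> of the Boolean list describes the gap after entry \<open>i\<close> of the string: true is a merge,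
  false is a comma. A run of merged entries is combined from left to right.
\<close>

fun merge_gaps :: "('a \<Rightarrow> 'a \<Rightarrow> 'a) \<Rightarrow> 'a list \<Rightarrow> bool list \<Rightarrow> 'a list" where
  "merge_gaps f (x # y # zs) (b # bs) =
     (if b then merge_gaps f (f x y # zs) bs else x # merge_gaps f (y # zs) bs)"
| "merge_gaps f xs bs = xs"

text \<open>
  A multiset, since sums run over all \<open>2 ^ (N - 1)\<close> choices, even if two choices should happen
  to produce the same triple.
\<close>

definition mergings :: "signed_nat list \<Rightarrow> nat list \<Rightarrow> int_theta list
    \<Rightarrow> (signed_nat list \<times> nat list \<times> int_theta list) multiset" where
  "mergings xs ys zs =
     image_mset
       (\<lambda>bs. (merge_gaps signed_plus xs bs, merge_gaps (+) ys bs, merge_gaps theta_plus zs bs))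
       (mset_set {bs. length bs = length xs - 1})"

text \<open>The sequences \<open>a\<close> and \<open>c\<close> are indexed from 1, up to \<open>l + 1\<close> and \<open>l\<close> respectively.\<close>

definition s_string :: "nat \<Rightarrow> (nat \<Rightarrow> nat) \<Rightarrow> (nat \<Rightarrow> nat) \<Rightarrow> signed_nat list" where
  "s_string l a c =
     concat (map (\<lambda>j. replicate (a j) (Unbarred 2) @ [Unbarred (c j)]) [1..<l + 1])
     @ replicate (a (l + 1)) (Unbarred 2)"

definition Pi_s :: "nat \<Rightarrow> (nat \<Rightarrow> nat) \<Rightarrow> (nat \<Rightarrow> nat)
    \<Rightarrow> (signed_nat list \<times> nat list \<times> int_theta list) multiset" where
  "Pi_s l a c =
     mergings
       ([Barred (2 * a 1 + 2)] @ replicate (c 1 - 3) (Unbarred 1)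
        @ concat (map (\<lambda>j. [Unbarred (2 * a j + 3)] @ replicate (c j - 3) (Unbarred 1)) [2..<l + 1])
        @ [Unbarred (2 * a (l + 1) + 1)])
       (concat (map (\<lambda>j. [a j + 1] @ replicate (c j - 3) 0) [1..<l + 1]) @ [a (l + 1)])
       ([Integer 1] @ concat (map (\<lambda>j. replicate (c j - 2) Theta) [1..<l + 1]))"

end

theory Submission
  imports Defs
begin

text \<open>
  Every entry but the first carries \<open>Theta\<close>, so the sum over all mergings of the strict chain sums
  is one sum over weakly decreasing chains, with a factor \<open>1 + q ^ k\<close> for each distinct index.
  It has the form \<open>\<Sum>k. W n k * F k\<close>, where
  \<open>W n k = (-1) ^ k * q ^ (k * (k - 1) div 2) * binom n k / binom (n + k) k\<close>.
  Two identities for the kernel \<open>W\<close> turn prefixing an entry to \<open>s\<close> into an operation on \<open>F\<close>: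
  \<open>(W n k - W (n - 1) k) * q ^ k / [k]\<^sup>2 = q ^ n / [n]\<^sup>2 * W n k\<close> shows that prefixing 2
  multiplies \<open>F k\<close> by \<open>q ^ k / [k]\<^sup>2\<close>, and the telescoping sum
  \<open>(\<Sum>k=j+1..n. (1 + q ^ k) * W n k) = W n j * ([j] / [n] - 1)\<close> shows that dividing the summand of
  \<open>H_star\<close> by a further \<open>[n]\<close> amounts to inserting one more entry \<open>1\<close> in the chain. For \<open>j = 0\<close>
  the latter is also the case of the empty string.
\<close>

section \<open>Sums over monotone index lists, by recursion on the first index\<close>

lemma finite_bounded_lists:
  "finite {ks. length ks = N \<and> set ks \<subseteq> {1..n::nat} \<and> P ks}"
  by (rule finite_subset[OF _ finite_lists_length_eq[of "{1..n}" N]]) auto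

text \<open>The bound \<open>g m\<close> on the later indices is \<open>m - 1\<close> for strict
  chains and \<open>m\<close> for weak ones, so one recursion serves both
  \<open>strict_chain_sum\<close> and \<open>H_star\<close>.\<close>

lemma sum_decreasing_lists_Suc:
  fixes f :: "nat list \<Rightarrow> real" and n :: nat
  assumes tail: "\<And>m ks. m \<in> {1..n} \<Longrightarrow> set ks \<subseteq> {1..n} \<and> (\<forall>k\<in>set ks. R m k) \<longleftrightarrow> set ks \<subseteq> {1..g m}"
  shows "(\<Sum>ks | length ks = Suc N \<and> set ks \<subseteq> {1..n} \<and> sorted_wrt R ks. f ks) =
    (\<Sum>m=1..n. \<Sum>ks | length ks = N \<and> set ks \<subseteq> {1..g m} \<and> sorted_wrt R ks. f (m # ks))"
proof -
  let ?T = "\<lambda>m. {ks. length ks = N \<and> set ks \<subseteq> {1..g m} \<and> sorted_wrt R ks}"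
  have "{ks. length ks = Suc N \<and> set ks \<subseteq> {1..n} \<and> sorted_wrt R ks}
      = (\<lambda>(m, ks). m # ks) ` Sigma {1..n} ?T" (is "?A = ?B")
  proof (intro equalityI subsetI)
    fix ks assume "ks \<in> ?A"
    then obtain m ks' where "ks = m # ks'" by (cases ks) auto
    with \<open>ks \<in> ?A\<close> have "m \<in> {1..n}" "ks' \<in> ?T m"
      using tail[of m ks'] by auto
    with \<open>ks = m # ks'\<close> show "ks \<in> ?B" by force
  next
    fix ks assume "ks \<in> ?B"
    then obtain m ks' where "ks = m # ks'" "m \<in> {1..n}" "ks' \<in> ?T m" by auto
    then show "ks \<in> ?A" using tail[of m ks'] by auto
  qed
  moreover have "inj_on (\<lambda>(m, ks). m # ks) (Sigma {1..n} ?T)"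
    by (auto simp: inj_on_def)
  ultimately show ?thesis
    by (simp add: sum.reindex sum.Sigma finite_bounded_lists o_def split_beta' del: One_nat_def)
qed

text \<open>The binomial quotient of \<open>H_cal\<close> depends on the first index only. With an
  arbitrary \<open>w\<close> in its place the recursion closes: once the first index is split off,
  the rest is a sum of the same kind with \<open>w\<close> constantly 1.\<close>

definition strict_chain_sum ::
  "real \<Rightarrow> (nat \<Rightarrow> real) \<Rightarrow> nat \<Rightarrow> signed_nat list \<Rightarrow> nat list \<Rightarrow> int_theta list \<Rightarrow> real" where
  "strict_chain_sum q w n s t r =
     (\<Sum>ks | length ks = length s \<and> set ks \<subseteq> {1..n} \<and> sorted_wrt (>) ks.
        w (ks ! 0)
        * (\<Prod>j<length s. signed_sgn (s ! j) ^ (ks ! j)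
             * q powi (int (t ! j * ks ! j) + Q_exponent (r ! j) (ks ! j))
             * (1 + q ^ (ks ! j))
             / q_number q (ks ! j) ^ signed_abs (s ! j)))"

text \<open>The factor \<open>1 + q ^ k\<close> is left out: a merged run contributes it only once,
  whereas the remaining weight is multiplicative when an unbarred entry with \<open>Theta\<close> is
  merged in from the right.\<close>

definition entry_weight :: "real \<Rightarrow> signed_nat \<Rightarrow> nat \<Rightarrow> int_theta \<Rightarrow> nat \<Rightarrow> real" where
  "entry_weight q x y z k =
     signed_sgn x ^ k * q powi (int (y * k) + Q_exponent z k) / q_number q k ^ signed_abs x"

lemma H_cal_eq_strict_chain_sum:
  "H_cal q n = strict_chain_sum q (\<lambda>k. q_binomial q n k / q_binomial q (n + k) k) n"
  by (simp add: fun_eq_iff H_cal_def strict_chain_sum_def)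

lemma strict_chain_sum_Nil: "strict_chain_sum q (\<lambda>_. 1) n [] t r = 1"
proof -
  have "{ks. length ks = 0 \<and> set ks \<subseteq> {1..n} \<and> sorted_wrt (>) ks} = {[]}" by auto
  then show ?thesis by (simp add: strict_chain_sum_def)
qed

lemma strict_chain_sum_Cons:
  "strict_chain_sum q w n (x # s) (y # t) (z # r) =
     (\<Sum>k=1..n. w k * (entry_weight q x y z k * (1 + q ^ k)) * strict_chain_sum q (\<lambda>_. 1) (k - 1) s t r)"
  unfolding strict_chain_sum_def length_Cons
  by (subst sum_decreasing_lists_Suc[where g = "\<lambda>k. k - 1"])
     (fastforce simp: subset_eq,
      simp add: prod.lessThan_Suc_shift sum_distrib_left entry_weight_def mult_ac del: prod.lessThan_Suc)

lemma H_star_Nil: "H_star q n [] = 1"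
proof -
  have "{ks. length ks = 0 \<and> set ks \<subseteq> {1..n} \<and> sorted_wrt (\<ge>) ks} = {[]}" by auto
  then show ?thesis by (simp add: H_star_def)
qed

lemma H_star_Cons:
  "H_star q n (Unbarred c # s) = (\<Sum>k=1..n. q ^ k / q_number q k ^ c * H_star q k s)"
  unfolding H_star_def length_Cons
  by (subst sum_decreasing_lists_Suc[where g = "\<lambda>k. k"])
     (fastforce simp: subset_eq,
      simp add: prod.lessThan_Suc_shift sum_distrib_left del: prod.lessThan_Suc)

section \<open>From mergings to weakly decreasing chains\<close>

lemma entry_weight_merge_Theta:
  assumes "q \<noteq> 0"
  shows "entry_weight q (signed_plus x (Unbarred x')) (y + y') (theta_plus z Theta) k
    = entry_weight q x y z k * (q ^ (y' * k) / q_number q k ^ x')"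
proof -
  have z: "theta_plus z Theta = z" by (cases z) auto
  have "q powi (int ((y + y') * k) + Q_exponent z k) = q powi (int (y * k) + Q_exponent z k) * q ^ (y' * k)"
    using assms by (simp add: power_int_add algebra_simps flip: power_int_of_nat)
  then show ?thesis
    by (cases x) (auto simp: entry_weight_def z power_add)
qed

lemma entry_weight_Theta:
  "entry_weight q (Unbarred x) y Theta k = q ^ (y * k) / q_number q k ^ x"
  by (simp add: entry_weight_def flip: power_int_of_nat)

text \<open>The source of the sign and the quadratic power of \<open>q\<close> in
  \<open>cal_kernel\<close>: the bar gives the former, \<open>Integer 1\<close> the latter.\<close>

lemma entry_weight_head:
  assumes "q \<noteq> 0"
  shows "entry_weight q (Barred x) y (Integer 1) k =
    (-1) ^ k * q ^ (k * (k - 1) div 2) * (q ^ (y * k) / q_number q k ^ x)"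
proof -
  have "int k * (int k - 1) div 2 = int (k * (k - 1) div 2)"
    by (cases k) (auto simp: zdiv_int algebra_simps)
  then show ?thesis
    using assms by (simp add: entry_weight_def power_int_add flip: power_int_of_nat)
qed

text \<open>One step of a weakly decreasing chain: either the next index equals \<open>k\<close>, in which case the
  two entries merge and the factor \<open>1 + q ^ k\<close> is already present, or it is smaller.\<close>

definition chain_step :: "real \<Rightarrow> (nat \<Rightarrow> real) \<Rightarrow> nat \<Rightarrow> real" where
  "chain_step q F k = F k + (1 + q ^ k) * (\<Sum>j=1..k-1. F j)"

text \<open>Sums over all ways to continue a run of index \<open>k\<close> by the listed entries,
  counting the factor \<open>1 + q ^ k\<close> of that run too; when no entry is left, only this
  factor remains.\<close>

fun tail_sum :: "real \<Rightarrow> (nat \<times> nat) list \<Rightarrow> nat \<Rightarrow> real" where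
  "tail_sum q [] = (\<lambda>k. 1 + q ^ k)"
| "tail_sum q ((x, y) # ps) = chain_step q (\<lambda>k. q ^ (y * k) / q_number q k ^ x * tail_sum q ps k)"

lemma bool_lists_Suc:
  "{bs :: bool list. length bs = Suc N} = (#) True ` {bs. length bs = N} \<union> (#) False ` {bs. length bs = N}"
  by (auto simp: length_Suc_conv image_iff)

lemma sum_bool_lists_Suc:
  fixes f :: "bool list \<Rightarrow> real"
  shows "(\<Sum>bs | length bs = Suc N. f bs) =
    (\<Sum>bs | length bs = N. f (True # bs)) + (\<Sum>bs | length bs = N. f (False # bs))"
proof -
  have "finite {bs :: bool list. length bs = N}"
    using finite_lists_length_eq[of "UNIV :: bool set" N] by simp
  then show ?thesis
    unfolding bool_lists_Suc
    by (subst sum.union_disjoint) (auto simp: sum.reindex)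
qed

text \<open>Case split on the first gap. A merge enlarges the head and keeps \<open>w\<close>; a
  comma makes the next entry the head of a chain below \<open>k\<close>, with \<open>w\<close>
  constantly 1. The two contributions are the two summands of \<open>chain_step\<close>.\<close>

lemma sum_merge_gaps:
  assumes "q \<noteq> 0"
  shows "(\<Sum>bs | length bs = length ps. strict_chain_sum q w n
      (merge_gaps signed_plus (x # map (\<lambda>p. Unbarred (fst p)) ps) bs)
      (merge_gaps (+) (y # map snd ps) bs)
      (merge_gaps theta_plus (z # replicate (length ps) Theta) bs))
    = (\<Sum>k=1..n. w k * (entry_weight q x y z k * tail_sum q ps k))"
proof (induction ps arbitrary: w n x y z)
  case Nil
  show ?case by (simp add: strict_chain_sum_Cons strict_chain_sum_Nil)
next
  case (Cons p ps)
  obtain x' y' where p: "p = (x', y')" by (cases p)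
  let ?d = "\<lambda>k. q ^ (y' * k) / q_number q k ^ x' * tail_sum q ps k"
  have "(\<Sum>bs | length bs = length ps. strict_chain_sum q w n
      (merge_gaps signed_plus (signed_plus x (Unbarred x') # map (\<lambda>p. Unbarred (fst p)) ps) bs)
      (merge_gaps (+) ((y + y') # map snd ps) bs)
      (merge_gaps theta_plus (theta_plus z Theta # replicate (length ps) Theta) bs))
    = (\<Sum>k=1..n. w k * (entry_weight q x y z k * ?d k))"
    by (simp only: Cons.IH entry_weight_merge_Theta[OF assms] mult.assoc)
  moreover have "(\<Sum>bs | length bs = length ps. strict_chain_sum q w n
      (x # merge_gaps signed_plus (Unbarred x' # map (\<lambda>p. Unbarred (fst p)) ps) bs)
      (y # merge_gaps (+) (y' # map snd ps) bs)
      (z # merge_gaps theta_plus (Theta # replicate (length ps) Theta) bs))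
    = (\<Sum>k=1..n. w k * (entry_weight q x y z k * ((1 + q ^ k) * (\<Sum>j=1..k-1. ?d j))))"
    unfolding strict_chain_sum_Cons
    by (subst sum.swap)
       (simp only: sum_distrib_left[symmetric] Cons.IH entry_weight_Theta mult_1 mult.assoc)
  ultimately show ?case
    by (simp only: p length_Cons sum_bool_lists_Suc list.map fst_conv snd_conv replicate_Suc
        merge_gaps.simps if_True if_False tail_sum.simps chain_step_def distrib_left sum.distrib)
qed

definition cal_kernel :: "real \<Rightarrow> nat \<Rightarrow> nat \<Rightarrow> real" where
  "cal_kernel q n k =
     (-1) ^ k * q ^ (k * (k - 1) div 2) * (q_binomial q n k / q_binomial q (n + k) k)"

definition cal_transform :: "real \<Rightarrow> nat \<Rightarrow> (nat \<Rightarrow> real) \<Rightarrow> real" where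
  "cal_transform q n F = (\<Sum>k=1..n. cal_kernel q n k * F k)"

lemma sum_mergings_H_cal:
  assumes "q \<noteq> 0"
  shows "(\<Sum>(p, p', p'') \<in># mergings (Barred x # map (\<lambda>p. Unbarred (fst p)) ps) (y # map snd ps)
        (Integer 1 # replicate (length ps) Theta). H_cal q n p p' p'')
    = cal_transform q n (\<lambda>k. q ^ (y * k) / q_number q k ^ x * tail_sum q ps k)"
proof -
  have "(\<Sum>(p, p', p'') \<in># mergings (Barred x # map (\<lambda>p. Unbarred (fst p)) ps) (y # map snd ps)
        (Integer 1 # replicate (length ps) Theta). H_cal q n p p' p'')
    = (\<Sum>bs | length bs = length ps. H_cal q n
      (merge_gaps signed_plus (Barred x # map (\<lambda>p. Unbarred (fst p)) ps) bs)
      (merge_gaps (+) (y # map snd ps) bs)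
      (merge_gaps theta_plus (Integer 1 # replicate (length ps) Theta) bs))"
    by (simp add: mergings_def sum_unfold_sum_mset multiset.map_comp o_def)
  then show ?thesis
    by (simp only: H_cal_eq_strict_chain_sum sum_merge_gaps[OF assms])
       (simp add: cal_transform_def cal_kernel_def entry_weight_head[OF assms] mult_ac)
qed

section \<open>Identities for the kernel\<close>

lemma q_pochhammer_Suc: "q_pochhammer q q (Suc n) = q_pochhammer q q n * (1 - q ^ Suc n)"
  by (simp add: q_pochhammer_def)

context
  fixes q :: real
  assumes q: "0 < q" "q < 1"
begin

lemma one_minus_power_pos: "k \<noteq> 0 \<Longrightarrow> 1 - q ^ k > 0"
  using q by (simp add: power_less_one_iff)

lemma q_number_pos: "k \<noteq> 0 \<Longrightarrow> q_number q k > 0"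
  using q one_minus_power_pos by (simp add: q_number_def)

lemma q_pochhammer_pos: "q_pochhammer q q n > 0"
  unfolding q_pochhammer_def
  using one_minus_power_pos[of "Suc _"] by (intro prod_pos) auto

lemma cal_kernel_eq:
  assumes "k \<le> n"
  shows "cal_kernel q n k = (-1) ^ k * q ^ (k * (k - 1) div 2) *
    ((q_pochhammer q q n)\<^sup>2 / (q_pochhammer q q (n - k) * q_pochhammer q q (n + k)))"
  using assms q_pochhammer_pos[of n] q_pochhammer_pos[of k]
  by (simp add: cal_kernel_def q_binomial_def power2_eq_square field_simps)

lemma cal_kernel_0: "cal_kernel q n 0 = 1"
  using q_pochhammer_pos[of n] by (simp add: cal_kernel_eq power2_eq_square)

lemma cal_kernel_eq_0: "n < k \<Longrightarrow> cal_kernel q n k = 0"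
  by (simp add: cal_kernel_def q_binomial_def)

text \<open>The cross-multiplied form includes \<open>k = Suc n\<close>, where both sides
  vanish.\<close>

lemma cal_kernel_Suc_left:
  assumes "k \<le> Suc n"
  shows "cal_kernel q n k * (1 - q ^ Suc n)\<^sup>2
    = cal_kernel q (Suc n) k * ((1 - q ^ (Suc n - k)) * (1 - q ^ (Suc n + k)))"
proof (cases "k = Suc n")
  case True
  then show ?thesis by (simp add: cal_kernel_eq_0)
next
  case False
  with assms obtain d where n: "n = k + d" using le_Suc_ex by (metis le_SucE)
  have d: "Suc n - k = Suc d" using n by simp
  have "1 - q ^ Suc d \<noteq> 0" "1 - q ^ Suc (n + k) \<noteq> 0"
    using one_minus_power_pos[of "Suc d"] one_minus_power_pos[of "Suc (n + k)"] by auto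
  then show ?thesis
    using q_pochhammer_pos[of d] q_pochhammer_pos[of "n + k"]
    by (simp add: cal_kernel_eq n d q_pochhammer_Suc power_mult_distrib del: power_Suc)
qed

lemma cal_kernel_Suc_right:
  assumes "j < n"
  shows "cal_kernel q n j * q ^ j * (1 - q ^ (n - j)) = - cal_kernel q n (Suc j) * (1 - q ^ (n + Suc j))"
proof -
  obtain d where n: "n = Suc (j + d)" using assms less_imp_Suc_add by blast
  have "Suc j * (Suc j - 1) div 2 = j * (j - 1) div 2 + j"
    by (cases j) (auto simp: algebra_simps)
  then have e: "q ^ (Suc j * (Suc j - 1) div 2) = q ^ (j * (j - 1) div 2) * q ^ j"
    by (simp only: power_add)
  have d: "n - j = Suc d" "n - Suc j = d" using n by auto
  have "1 - q ^ Suc d \<noteq> 0" "1 - q ^ Suc (n + j) \<noteq> 0"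
    using one_minus_power_pos[of "Suc d"] one_minus_power_pos[of "Suc (n + j)"] by auto
  then show ?thesis
    using q_pochhammer_pos[of d] q_pochhammer_pos[of "n + j"] assms
    by (simp add: cal_kernel_eq[of j] cal_kernel_eq[of "Suc j", unfolded e] d q_pochhammer_Suc mult_ac
        del: power_Suc) (simp add: mult_ac)
qed

text \<open>With \<open>A = q ^ (Suc n - k)\<close> and \<open>B = q ^ k\<close>, this rests on
  \<open>(1 - A*B)^2 - (1 - A)*(1 - A*B*B) = A*(1 - B)^2\<close>.\<close>

lemma cal_kernel_diff:
  assumes "1 \<le> k" "k \<le> Suc n"
  shows "(cal_kernel q (Suc n) k - cal_kernel q n k) * (q ^ k / (q_number q k)\<^sup>2)
    = q ^ Suc n / (q_number q (Suc n))\<^sup>2 * cal_kernel q (Suc n) k"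
proof -
  define A B where "A = q ^ (Suc n - k)" and "B = q ^ k"
  let ?K = "cal_kernel q (Suc n) k"
  have AB: "q ^ Suc n = A * B" "q ^ (Suc n + k) = A * B * B"
    using assms(2) unfolding A_def B_def by (simp_all flip: power_add)
  have nz: "1 - B \<noteq> 0" "1 - A * B \<noteq> 0"
    using one_minus_power_pos[of k] one_minus_power_pos[of "Suc n"] assms(1) unfolding AB B_def by auto
  have "cal_kernel q n k * (1 - A * B)\<^sup>2 = ?K * ((1 - A) * (1 - A * B * B))"
    using cal_kernel_Suc_left[OF assms(2)] unfolding AB A_def[symmetric] .
  then have "(?K - cal_kernel q n k) * (1 - A * B)\<^sup>2 = ?K * (A * (1 - B)\<^sup>2)"
    by (simp add: left_diff_distrib) (simp add: power2_eq_square algebra_simps)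
  then have "?K - cal_kernel q n k = ?K * (A * (1 - B)\<^sup>2) / (1 - A * B)\<^sup>2"
    using nz by (simp add: eq_divide_eq)
  then show ?thesis
    unfolding q_number_def AB B_def[symmetric] using nz q by (simp add: power_divide)
qed

lemma sum_cal_kernel_above:
  assumes "j \<le> n" "n \<ge> 1"
  shows "(\<Sum>k=Suc j..n. (1 + q ^ k) * cal_kernel q n k)
    = cal_kernel q n j * (q_number q j / q_number q n - 1)"
proof -
  define V where "V = (\<lambda>j. cal_kernel q n j * (q_number q j / q_number q n - 1))"
  have V_eq: "V j = cal_kernel q n j * ((q ^ n - q ^ j) / (1 - q ^ n))" for j
    using one_minus_power_pos[of n] q assms(2)
    by (simp add: V_def q_number_def divide_simps)
  \<comment> \<open>Both values of \<open>V\<close> become multiples of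
    \<open>cal_kernel q n (Suc j)\<close>; then \<open>(1 - q^(n+j+1)) - (q^n - q^(j+1)) = (1 - q^n)
    * (1 + q^(j+1))\<close>.\<close>
  have V_diff: "(1 + q ^ Suc j) * cal_kernel q n (Suc j) = V j - V (Suc j)" if "j < n" for j
  proof -
    have p: "1 - q ^ n \<noteq> 0" using one_minus_power_pos[of n] assms(2) by simp
    have "q ^ n = q ^ j * q ^ (n - j)" using that by (simp flip: power_add)
    then have "cal_kernel q n j * (q ^ n - q ^ j) = cal_kernel q n (Suc j) * (1 - q ^ n * q ^ Suc j)"
      using cal_kernel_Suc_right[OF that] by (simp add: power_add algebra_simps)
    then have "V j = cal_kernel q n (Suc j) * (1 - q ^ n * q ^ Suc j) / (1 - q ^ n)"
      by (simp only: V_eq times_divide_eq_right)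
    then show ?thesis using p
      by (simp add: V_eq eq_divide_eq diff_divide_distrib[symmetric] del: power_Suc)
         (simp add: algebra_simps)
  qed
  have "(\<Sum>k=Suc j..n. (1 + q ^ k) * cal_kernel q n k)
      = (\<Sum>i=j..<n. (1 + q ^ Suc i) * cal_kernel q n (Suc i))"
    by (rule sum.reindex_bij_witness[of _ Suc "\<lambda>k. k - 1"]) auto
  also have "\<dots> = (\<Sum>i=j..<n. V i - V (Suc i))"
    by (intro sum.cong) (auto simp: V_diff simp del: power_Suc)
  also have "\<dots> = - (\<Sum>i=j..<n. V (Suc i) - V i)"
    by (simp add: sum_negf[symmetric])
  also have "\<dots> = V j - V n"
    using sum_Suc_diff'[OF assms(1), of V] by simp
  also have "V n = 0" by (simp add: V_eq)
  finally show ?thesis by (simp add: V_def)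
qed

section \<open>Prefixing entries, seen through the transform\<close>

lemma cal_transform_base:
  assumes "n \<ge> 1"
  shows "cal_transform q n (\<lambda>k. 1 + q ^ k) = -1"
  using sum_cal_kernel_above[of 0 n] assms
  by (simp add: cal_transform_def cal_kernel_0 q_number_def mult.commute)

text \<open>After exchanging the sums, the \<open>- 1\<close> in \<open>sum_cal_kernel_above\<close>
  cancels the merged term of \<open>chain_step\<close>, and its \<open>q_number q j\<close> cancels
  the denominator under \<open>F j\<close>.\<close>

lemma cal_transform_chain_step:
  assumes "n \<ge> 1"
  shows "cal_transform q n (chain_step q (\<lambda>k. F k / q_number q k)) = cal_transform q n F / q_number q n"
proof -
  let ?G = "\<lambda>k. F k / q_number q k"
  have "(\<Sum>k=1..n. cal_kernel q n k * ((1 + q ^ k) * (\<Sum>j=1..k-1. ?G j)))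
      = (\<Sum>k=1..n. \<Sum>j | j \<in> {1..n} \<and> j < k. cal_kernel q n k * ((1 + q ^ k) * ?G j))"
    by (auto simp: sum_distrib_left intro!: sum.cong)
  also have "\<dots> = (\<Sum>j=1..n. \<Sum>k | k \<in> {1..n} \<and> j < k. cal_kernel q n k * ((1 + q ^ k) * ?G j))"
    by (rule sum.swap_restrict) auto
  also have "\<dots> = (\<Sum>j=1..n. ?G j * (\<Sum>k=Suc j..n. (1 + q ^ k) * cal_kernel q n k))"
    by (auto simp: sum_distrib_left mult_ac intro!: sum.cong)
  also have "\<dots> = (\<Sum>j=1..n. ?G j * (cal_kernel q n j * (q_number q j / q_number q n - 1)))"
    using assms by (auto simp: sum_cal_kernel_above intro!: sum.cong)
  finally have *: "(\<Sum>k=1..n. cal_kernel q n k * ((1 + q ^ k) * (\<Sum>j=1..k-1. ?G j)))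
      = (\<Sum>j=1..n. ?G j * (cal_kernel q n j * (q_number q j / q_number q n - 1)))" .
  have "cal_transform q n (chain_step q ?G)
      = (\<Sum>j=1..n. cal_kernel q n j * ?G j + ?G j * (cal_kernel q n j * (q_number q j / q_number q n - 1)))"
    unfolding cal_transform_def chain_step_def by (simp only: distrib_left sum.distrib *)
  also have "\<dots> = (\<Sum>j=1..n. cal_kernel q n j * F j / q_number q n)"
  proof (intro sum.cong refl)
    fix j assume "j \<in> {1..n}"
    then have "q_number q j \<noteq> 0" "q_number q n \<noteq> 0"
      using q_number_pos[of j] q_number_pos[of n] by auto
    then show "cal_kernel q n j * ?G j + ?G j * (cal_kernel q n j * (q_number q j / q_number q n - 1))
        = cal_kernel q n j * F j / q_number q n"
      by (simp add: field_simps)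
  qed
  finally show ?thesis by (simp add: cal_transform_def sum_divide_distrib)
qed

lemma cal_transform_chain_step_iterate:
  assumes "n \<ge> 1"
  shows "cal_transform q n (((\<lambda>G. chain_step q (\<lambda>k. G k / q_number q k)) ^^ m) F)
    = cal_transform q n F / q_number q n ^ m"
  by (induction m) (simp_all add: cal_transform_chain_step[OF assms])

lemma cal_transform_two:
  "cal_transform q n (\<lambda>k. q ^ k / (q_number q k)\<^sup>2 * F k)
    = (\<Sum>m=1..n. q ^ m / (q_number q m)\<^sup>2 * cal_transform q m F)"
proof (induction n)
  case 0
  show ?case by (simp add: cal_transform_def)
next
  case (Suc n)
  let ?G = "\<lambda>k. q ^ k / (q_number q k)\<^sup>2 * F k"
  \<comment> \<open>The kernel vanishes at \<open>k = Suc n\<close>, so both sums can share the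
    range up to \<open>Suc n\<close>.\<close>
  have "cal_transform q n ?G = (\<Sum>k=1..Suc n. cal_kernel q n k * ?G k)"
    by (simp add: cal_transform_def cal_kernel_eq_0)
  then have "cal_transform q (Suc n) ?G - cal_transform q n ?G
      = (\<Sum>k=1..Suc n. (cal_kernel q (Suc n) k - cal_kernel q n k) * (q ^ k / (q_number q k)\<^sup>2) * F k)"
    unfolding cal_transform_def[of q "Suc n"]
    by (simp only: sum_subtractf[symmetric] left_diff_distrib mult.assoc)
  also have "\<dots> = (\<Sum>k=1..Suc n. q ^ Suc n / (q_number q (Suc n))\<^sup>2 * cal_kernel q (Suc n) k * F k)"
    by (intro sum.cong refl) (simp only: cal_kernel_diff atLeastAtMost_iff)
  also have "\<dots> = q ^ Suc n / (q_number q (Suc n))\<^sup>2 * cal_transform q (Suc n) F"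
    by (simp only: cal_transform_def sum_distrib_left mult.assoc)
  finally show ?case using Suc.IH by simp
qed

lemma H_star_replicate_two:
  assumes "\<And>n. n \<ge> 1 \<Longrightarrow> H_star q n s = - cal_transform q n F" and "n \<ge> 1"
  shows "H_star q n (replicate a (Unbarred 2) @ s)
    = - cal_transform q n (\<lambda>k. q ^ (a * k) / q_number q k ^ (2 * a) * F k)"
  using assms(2)
proof (induction a arbitrary: n)
  case 0
  then show ?case by (simp add: assms(1))
next
  case (Suc a)
  let ?G = "\<lambda>k. q ^ (a * k) / q_number q k ^ (2 * a) * F k"
  have "H_star q n (replicate (Suc a) (Unbarred 2) @ s)
      = (\<Sum>k=1..n. q ^ k / q_number q k ^ 2 * - cal_transform q k ?G)"
    by (simp add: H_star_Cons Suc.IH)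
  also have "\<dots> = - cal_transform q n (\<lambda>k. q ^ k / (q_number q k)\<^sup>2 * ?G k)"
    by (simp only: cal_transform_two mult_minus_right sum_negf)
  finally show ?case by (simp add: power_add power2_eq_square mult_ac)
qed

text \<open>Two of the \<open>c\<close> denominators are absorbed by
  \<open>cal_transform_two\<close>; each of the other \<open>c - 2\<close> costs one chain
  step.\<close>

lemma H_star_Cons_ge_2:
  assumes "\<And>n. n \<ge> 1 \<Longrightarrow> H_star q n s = - cal_transform q n F" and "c \<ge> 2"
  shows "H_star q n (Unbarred c # s) = - cal_transform q n (\<lambda>k. q ^ k / (q_number q k)\<^sup>2
    * ((\<lambda>G. chain_step q (\<lambda>k. G k / q_number q k)) ^^ (c - 2)) F k)"
proof -
  have c: "q_number q k ^ c = (q_number q k)\<^sup>2 * q_number q k ^ (c - 2)" for k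
    using assms(2) by (metis le_add_diff_inverse power_add)
  show ?thesis
    unfolding cal_transform_two H_star_Cons
    by (simp add: cal_transform_chain_step_iterate assms(1) c sum_negf)
qed

section \<open>Assembling the blocks of the string\<close>

lemma tail_sum_replicate:
  "tail_sum q (replicate m (1, 0) @ ps)
    = ((\<lambda>G. chain_step q (\<lambda>k. G k / q_number q k)) ^^ m) (tail_sum q ps)"
  by (induction m) simp_all

end

text \<open>The length \<open>b\<close> of the final run of twos is kept apart from the list
  \<open>js\<close>, so it stays fixed in the induction over blocks.\<close>

definition block_tail :: "(nat \<Rightarrow> nat) \<Rightarrow> (nat \<Rightarrow> nat) \<Rightarrow> nat \<Rightarrow> nat list \<Rightarrow> (nat \<times> nat) list" where
  "block_tail a c b js =
     concat (map (\<lambda>j. (2 * a j + 3, a j + 1) # replicate (c j - 3) (1, 0)) js) @ [(2 * b + 1, b)]"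

text \<open>The leading exponents \<open>2 * b\<close> and \<open>2 * a j + 2\<close> are one less than in \<open>block_tail\<close>: the missing
  factor comes from the entry \<open>c\<close> that precedes the block there.\<close>

fun block_fun :: "real \<Rightarrow> (nat \<Rightarrow> nat) \<Rightarrow> (nat \<Rightarrow> nat) \<Rightarrow> nat \<Rightarrow> nat list \<Rightarrow> nat \<Rightarrow> real" where
  "block_fun q a c b [] k = q ^ (b * k) / q_number q k ^ (2 * b) * (1 + q ^ k)"
| "block_fun q a c b (j # js) k = q ^ ((a j + 1) * k) / q_number q k ^ (2 * a j + 2)
     * tail_sum q (replicate (c j - 3) (1, 0) @ block_tail a c b js) k"

lemma tail_sum_block_tail:
  "tail_sum q (block_tail a c b js) = chain_step q (\<lambda>k. block_fun q a c b js k / q_number q k)"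
  by (cases js) (simp_all add: block_tail_def power_add mult_ac numeral_3_eq_3)

lemma H_star_blocks:
  assumes q: "0 < q" "q < 1" and c: "\<And>j. j \<in> set js \<Longrightarrow> c j \<ge> 3" and "n \<ge> 1"
  shows "H_star q n (concat (map (\<lambda>j. replicate (a j) (Unbarred 2) @ [Unbarred (c j)]) js)
      @ replicate b (Unbarred 2)) = - cal_transform q n (block_fun q a c b js)"
  using c \<open>n \<ge> 1\<close>
proof (induction js arbitrary: n)
  case Nil
  have "block_fun q a c b [] = (\<lambda>k. q ^ (b * k) / q_number q k ^ (2 * b) * (1 + q ^ k))" by auto
  then show ?case
    using H_star_replicate_two[OF q, of "[]" "\<lambda>k. 1 + q ^ k" n b] cal_transform_base[OF q] Nil.prems
    by (simp add: H_star_Nil)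
next
  case (Cons j js)
  let ?s = "concat (map (\<lambda>j. replicate (a j) (Unbarred 2) @ [Unbarred (c j)]) js) @ replicate b (Unbarred 2)"
  let ?F = "((\<lambda>G. chain_step q (\<lambda>k. G k / q_number q k)) ^^ (c j - 2)) (block_fun q a c b js)"
  have cj: "c j - 2 = Suc (c j - 3)" "c j \<ge> 2" using Cons.prems(1)[of j] by auto
  have "H_star q n (Unbarred (c j) # ?s) = - cal_transform q n (\<lambda>k. q ^ k / (q_number q k)\<^sup>2 * ?F k)" for n
    by (rule H_star_Cons_ge_2[OF q _ cj(2)]) (use Cons in auto)
  then have "H_star q n (replicate (a j) (Unbarred 2) @ Unbarred (c j) # ?s)
      = - cal_transform q n (\<lambda>k. q ^ (a j * k) / q_number q k ^ (2 * a j) * (q ^ k / (q_number q k)\<^sup>2 * ?F k))"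
    by (rule H_star_replicate_two[OF q _ Cons.prems(2)])
  \<comment> \<open>The innermost of the \<open>c j - 2\<close> chain steps turns
    \<open>block_fun\<close> into the \<open>tail_sum\<close> of the later blocks; the other
    \<open>c j - 3\<close> are the entries 1.\<close>
  also have "?F = tail_sum q (replicate (c j - 3) (1, 0) @ block_tail a c b js)"
    by (simp only: cj(1) funpow_Suc_right o_apply tail_sum_replicate[OF q] tail_sum_block_tail)
  also have "(\<lambda>k. q ^ (a j * k) / q_number q k ^ (2 * a j) * (q ^ k / (q_number q k)\<^sup>2
        * tail_sum q (replicate (c j - 3) (1, 0) @ block_tail a c b js) k)) = block_fun q a c b (j # js)"
    by (auto simp: fun_eq_iff power_add power2_eq_square mult_ac)
  finally show ?case by simp
qed

lemma concat_map_replicate: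
  "concat (map (\<lambda>j. replicate (f j) x) js) = replicate (sum_list (map f js)) x"
  by (induction js) (simp_all add: replicate_add)

text \<open>The lengths agree because the \<open>c j - 2\<close> copies of \<open>Theta\<close> pair
  with the \<open>c j - 3\<close> ones and the entry opening the next block, or the last entry if
  \<open>j = l\<close>.\<close>

lemma Pi_s_eq:
  fixes a c :: "nat \<Rightarrow> nat"
  assumes "l \<ge> 1" and c: "\<And>j. 1 \<le> j \<Longrightarrow> j \<le> l \<Longrightarrow> c j \<ge> 3"
  defines "ps \<equiv> replicate (c 1 - 3) (1, 0) @ block_tail a c (a (l + 1)) [2..<l + 1]"
  shows "Pi_s l a c = mergings (Barred (2 * a 1 + 2) # map (\<lambda>p. Unbarred (fst p)) ps)
     ((a 1 + 1) # map snd ps) (Integer 1 # replicate (length ps) Theta)"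
proof -
  have upt: "[1..<l + 1] = 1 # [2..<l + 1]"
    using assms(1) by (simp add: upt_rec numeral_2_eq_2)
  have "c j - 2 = Suc (c j - 3)" if "j \<in> set [2..<l + 1]" for j
    using c[of j] that by (auto simp del: upt_Suc)
  then have "sum_list (map (\<lambda>j. c j - 2) [2..<l + 1]) = sum_list (map (\<lambda>j. Suc (c j - 3)) [2..<l + 1])"
    by (intro arg_cong[where f = sum_list] map_cong refl)
  moreover have "c 1 - 2 = Suc (c 1 - 3)" using c[of 1] assms(1) by simp
  ultimately have thetas: "concat (map (\<lambda>j. replicate (c j - 2) Theta) [1..<l + 1]) = replicate (length ps) Theta"
    unfolding concat_map_replicate upt
    by (simp add: ps_def block_tail_def length_concat o_def)
  show ?thesis
    unfolding Pi_s_def thetas unfolding upt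
    by (simp add: ps_def block_tail_def map_concat o_def del: upt_Suc)
qed

theorem theorem6p1:
  fixes q :: real and l n :: nat and a c :: "nat \<Rightarrow> nat"
  assumes "0 < q" and "q < 1"
    and "l \<ge> 1"
    and "\<And>j. 1 \<le> j \<Longrightarrow> j \<le> l \<Longrightarrow> c j \<ge> 3"
    and "n \<ge> 1"
  shows "H_star q n (s_string l a c) = - (\<Sum>(p, p', p'') \<in># Pi_s l a c. H_cal q n p p' p'')"
proof -
  have upt: "[1..<l + 1] = 1 # [2..<l + 1]"
    using assms(3) by (simp add: upt_rec numeral_2_eq_2)
  have "H_star q n (s_string l a c) = - cal_transform q n (block_fun q a c (a (l + 1)) [1..<l + 1])"
    unfolding s_string_def by (rule H_star_blocks) (use assms in auto)
  \<comment> \<open>Unfolding the first block yields the function that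
    \<open>sum_mergings_H_cal\<close> attaches to the barred head.\<close>
  also have "block_fun q a c (a (l + 1)) [1..<l + 1] = (\<lambda>k. q ^ ((a 1 + 1) * k) / q_number q k ^ (2 * a 1 + 2)
     * tail_sum q (replicate (c 1 - 3) (1, 0) @ block_tail a c (a (l + 1)) [2..<l + 1]) k)"
    unfolding upt by (simp only: block_fun.simps fun_eq_iff) simp
  finally show ?thesis
    using assms(1) by (simp only: Pi_s_eq[OF assms(3,4)] sum_mergings_H_cal)
qed

end
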